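(* Let $F(z)=\sum_{n=0}^{\infty}a_{n}z^{n}$ be an entire function satisfying (S1) or (S2). Let $\tau$ be a complex number and assume $|\tau|<1/(2\sigma)$ in situation (S2). Then the two series $$e^{-\tau D^{2}/2}F(z)=\sum_{k=0}^{\infty}\frac{1}{k!}\left(-\frac{\tau}{2}D^{2}\right)^{k}F(z)\qquad\text{and}\qquad e^{-\tau D^{2}/2}F(z)=\sum_{n=0}^{\infty}a_{n}(\sqrt{\tau})^{n}\operatorname{He}_{n}\left(\frac{z}{\sqrt{\tau}}\right)$$ both converge to the same limit for all $z\in\mathbb{C}$. In the second series, either of the two square roots of $\tau$ may be used. The convergence is absolute and uniform in $z$ and $\tau$ if (i) $|z|\leq C_{1}$ and $|\tau|\leq C_{2}$ for any constants $C_{1},C_{2}>0$ in situation (S1), (ii) $|z|\leq C_{1}$ and $|\tau|\leq C_{2}$ for any $C_{1}>0$ and any $C_{2}<1/(2\sigma)$ in situation (S2). In particular, both series define the same holomorphic function of the two variables $(z,\tau)$ in the domain $\mathbb{C}^{2}$ for (S1) and $\mathbb{C}\times\{|\tau|<1/(2\sigma)\}$ for (S2).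
   Context: $D=d/dz$. For an entire function $F$ let $M(r)=\sup_{|z|=r}|F(z)|$. The order $\rho\in[0,\infty]$ of $F$ is the infimum of all $\mu>0$ with $M(r)<\exp\{r^\mu\}$ for all sufficiently large $r$; if $\rho<\infty$, the type $\sigma\in[0,\infty]$ is the infimum of all $a\ge0$ with $M(r)\le\exp\{ar^\rho\}$ for all sufficiently large $r$. (S1): $F$ is an entire function of order $\rho<2$. (S2): $F$ is an entire function of order $\rho=2$ and finite type $\sigma\ge0$. Convention: $1/(2\sigma)=+\infty$ if $\sigma=0$. $\operatorname{He}_n(z)=n!\sum_{m=0}^{[n/2]}\frac{(-1)^m}{m!2^m}\frac{z^{n-2m}}{(n-2m)!}$ is the $n$-th (probabilists') Hermite polynomial. The expression $(\sqrt\tau)^n\operatorname{He}_n(z/\sqrt\tau)$ is a polynomial in $z$ and $\tau$, and for $\tau=0$ it is understood as its analytic continuation $z^n$. *)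

theory Defs
  imports "HOL-Complex_Analysis.Complex_Analysis"
begin

definition max_modulus :: "(complex \<Rightarrow> complex) \<Rightarrow> real \<Rightarrow> real" where
  "max_modulus F r = (SUP z\<in>sphere 0 r. norm (F z))"

text \<open>
  The infima are taken in the extended reals, so that an empty set of exponents
  (or constants) gives \<open>\<infinity>\<close>.
\<close>

definition entire_order :: "(complex \<Rightarrow> complex) \<Rightarrow> ereal" where
  "entire_order F =
     Inf {ereal \<mu> |\<mu>. \<mu> > 0 \<and> (\<forall>\<^sub>F r in at_top. max_modulus F r < exp (r powr \<mu>))}"

text \<open>Only meaningful for functions of finite order.\<close>

definition entire_type :: "(complex \<Rightarrow> complex) \<Rightarrow> ereal" where
  "entire_type F =
     Inf {ereal a |a. a \<ge> 0 \<and>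
       (\<forall>\<^sub>F r in at_top. max_modulus F r \<le> exp (a * r powr real_of_ereal (entire_order F)))}"

definition situation_S1 :: "(complex \<Rightarrow> complex) \<Rightarrow> bool" where
  "situation_S1 F \<longleftrightarrow> F holomorphic_on UNIV \<and> entire_order F < 2"

definition situation_S2 :: "(complex \<Rightarrow> complex) \<Rightarrow> bool" where
  "situation_S2 F \<longleftrightarrow> F holomorphic_on UNIV \<and> entire_order F = 2 \<and> entire_type F < \<infinity>"

text \<open>The number \<open>1 / (2\<sigma>)\<close>, where \<open>\<sigma>\<close> is the type.\<close>

definition tau_bound :: "(complex \<Rightarrow> complex) \<Rightarrow> ereal" where
  "tau_bound F = (if entire_type F = 0 then \<infinity> else 1 / (2 * entire_type F))"

definition He :: "nat \<Rightarrow> complex \<Rightarrow> complex" where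
  "He n z = fact n * (\<Sum>m=0..n div 2. (-1) ^ m / (fact m * 2 ^ m) * (z ^ (n - 2 * m) / fact (n - 2 * m)))"

text \<open>
  The argument \<open>s\<close> is a square root of \<open>\<tau>\<close>; for \<open>\<tau> = 0\<close> the expression
  \<open>s ^ n * He n (z / s)\<close> stands for its continuation \<open>z ^ n\<close>.
\<close>

definition scaled_He :: "complex \<Rightarrow> nat \<Rightarrow> complex \<Rightarrow> complex" where
  "scaled_He s n z = (if s = 0 then z ^ n else s ^ n * He n (z / s))"

definition heat_operator :: "complex \<Rightarrow> (complex \<Rightarrow> complex) \<Rightarrow> complex \<Rightarrow> complex" where
  "heat_operator \<tau> G = (\<lambda>z. - (\<tau> / 2) * (deriv ^^ 2) G z)"

definition heat_term :: "(complex \<Rightarrow> complex) \<Rightarrow> nat \<Rightarrow> complex \<Rightarrow> complex \<Rightarrow> complex" where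
  "heat_term F k z \<tau> = 1 / fact k * (heat_operator \<tau> ^^ k) F z"

text \<open>
  Both the series itself and the series of its absolute values converge uniformly;
  the latter includes absolute convergence at every point.
\<close>

definition abs_uniformly_summable_on :: "(nat \<Rightarrow> 'a \<Rightarrow> 'b::banach) \<Rightarrow> 'a set \<Rightarrow> bool" where
  "abs_uniformly_summable_on f K \<longleftrightarrow>
     uniformly_convergent_on K (\<lambda>N p. \<Sum>n<N. f n p) \<and>
     uniformly_convergent_on K (\<lambda>N p. \<Sum>n<N. norm (f n p))"

text \<open>
  Holomorphy in two variables on an open set: the real Frechet derivative exists at
  every point and is complex linear.
\<close>

definition holomorphic2_on :: "(complex \<times> complex \<Rightarrow> complex) \<Rightarrow> (complex \<times> complex) set \<Rightarrow> bool" where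
  "holomorphic2_on f S \<longleftrightarrow>
     open S \<and> (\<forall>p\<in>S. \<exists>A B. (f has_derivative (\<lambda>(h, k). A * h + B * k)) (at p))"

end

theory Submission
  imports Defs "HOL-Real_Asymp.Real_Asymp"
begin

text \<open>
  Both series are the iterated sums, in the two possible orders, of the double series with terms
  \<open>a\<^sub>n n! / (m! (n - 2m)!) (- \<tau> / 2)\<^sup>m z\<^sup>n\<^sup>-\<^sup>2\<^sup>m\<close>. For \<open>norm z \<le> x\<close> and \<open>norm \<tau> \<le> y\<close> the absolute values of
  row \<open>n\<close> add up to at most \<open>norm a\<^sub>n * p\<^sub>n\<close>, where \<open>p\<^sub>n / n!\<close> is the \<open>n\<close>-th Taylor coefficient of
  \<open>exp (x t + y t\<^sup>2 / 2)\<close>. If \<open>norm (F z) \<le> K exp (b (norm z)\<^sup>2)\<close>, then Cauchy's estimates for \<open>F\<close> and for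
  this exponential together with Stirling's bound give \<open>norm a\<^sub>n * p\<^sub>n = O(n (2by)\<^sup>n\<^sup>/\<^sup>2 exp (c \<surd>n))\<close>, which is
  summable as soon as \<open>2by < 1\<close>. This yields absolute and uniform convergence and the equality of
  the sums. The same summability passes to \<open>F'\<close> and \<open>F''\<close>, so the series can be differentiated
  term by term in both variables.
\<close>

section \<open>Majorants of the Hermite polynomials\<close>

text \<open>The value 0 for \<open>2 * m > n\<close> lets the double series run over all pairs
  \<open>(n, m)\<close>; truncated subtraction would otherwise produce spurious terms there.\<close>

definition hermite_coeff :: "nat \<Rightarrow> nat \<Rightarrow> real" where
  "hermite_coeff n m = (if 2 * m \<le> n then fact n / (fact m * fact (n - 2 * m)) else 0)"

text \<open>The heat polynomial, i.e. \<open>scaled_He s n x\<close> with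
  \<open>s\<^sup>2 = - y\<close>: this choice removes all signs, so for nonnegative \<open>x\<close>
  and \<open>y\<close> every summand is nonnegative.\<close>

definition hermite_majorant :: "real \<Rightarrow> real \<Rightarrow> nat \<Rightarrow> real" where
  "hermite_majorant x y n = (\<Sum>m\<le>n div 2. hermite_coeff n m * (y / 2) ^ m * x ^ (n - 2 * m))"

text \<open>All \<open>x\<close> are required at once because differentiating \<open>F\<close>
  enlarges \<open>x\<close> by 1, while \<open>y\<close> has to stay fixed.\<close>

definition gauss_summable :: "(nat \<Rightarrow> complex) \<Rightarrow> real \<Rightarrow> bool" where
  "gauss_summable a y \<longleftrightarrow> (\<forall>x\<ge>0. summable (\<lambda>n. norm (a n) * hermite_majorant x y n))"

lemma hermite_coeff_nonneg [simp]: "hermite_coeff n m \<ge> 0"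
  by (simp add: hermite_coeff_def)

lemma hermite_majorant_nonneg [simp]: "x \<ge> 0 \<Longrightarrow> y \<ge> 0 \<Longrightarrow> hermite_majorant x y n \<ge> 0"
  by (auto simp: hermite_majorant_def intro!: sum_nonneg mult_nonneg_nonneg)

lemma hermite_majorant_mono:
  assumes "0 \<le> x" "x \<le> x'" "0 \<le> y" "y \<le> y'"
  shows "hermite_majorant x y n \<le> hermite_majorant x' y' n"
  unfolding hermite_majorant_def
  using assms by (intro sum_mono mult_mono mult_nonneg_nonneg power_mono) auto

lemma power_div_fact_le_exp:
  fixes x :: real
  assumes "x \<ge> 0" "finite A"
  shows "(\<Sum>j\<in>A. x ^ j / fact j) \<le> exp x"
proof -
  have "(\<lambda>n. x ^ n / fact n) sums exp x"
    using exp_converges[of x] by (simp add: divide_inverse mult.commute)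
  then show ?thesis
    using sum_le_suminf[of "\<lambda>n. x ^ n / fact n" A] assms by (auto simp: sums_iff)
qed

text \<open>
  Since \<open>hermite_majorant x y n / n!\<close> is the \<open>n\<close>-th Taylor coefficient of
  \<open>t \<mapsto> exp (x t + y t\<^sup>2 / 2)\<close>, this is Cauchy's estimate.
\<close>

lemma hermite_majorant_le:
  assumes "x \<ge> 0" "y \<ge> 0" "t \<ge> 0"
  shows "hermite_majorant x y n * t ^ n \<le> fact n * exp (x * t + y * t\<^sup>2 / 2)"
proof -
  \<comment> \<open>The power of \<open>x * t\<close> is bounded by the whole exponential; the
    powers of \<open>y * t\<^sup>2 / 2\<close> are kept and summed over \<open>m\<close>
    afterwards.\<close>
  have *: "hermite_coeff n m * (y / 2) ^ m * x ^ (n - 2 * m) * t ^ n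
      \<le> fact n * exp (x * t) * ((y * t\<^sup>2 / 2) ^ m / fact m)" if "m \<le> n div 2" for m
  proof -
    have m: "2 * m \<le> n" using that by simp
    have tn: "t ^ n = t ^ (n - 2 * m) * (t\<^sup>2) ^ m"
      using m by (simp flip: power_mult power_add)
    have "hermite_coeff n m * (y / 2) ^ m * x ^ (n - 2 * m) * t ^ n
        = fact n * ((x * t) ^ (n - 2 * m) / fact (n - 2 * m)) * ((y * t\<^sup>2 / 2) ^ m / fact m)"
      using m by (simp add: hermite_coeff_def tn power_mult_distrib power_divide mult_ac)
    also have "\<dots> \<le> fact n * exp (x * t) * ((y * t\<^sup>2 / 2) ^ m / fact m)"
      using power_div_fact_le_exp[of "x * t" "{n - 2 * m}"] assms
      by (intro mult_right_mono mult_left_mono) auto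
    finally show ?thesis .
  qed
  have "hermite_majorant x y n * t ^ n
      \<le> (\<Sum>m\<le>n div 2. fact n * exp (x * t) * ((y * t\<^sup>2 / 2) ^ m / fact m))"
    unfolding hermite_majorant_def sum_distrib_right using * by (intro sum_mono) auto
  also have "\<dots> = fact n * exp (x * t) * (\<Sum>m\<le>n div 2. (y * t\<^sup>2 / 2) ^ m / fact m)"
    by (simp only: sum_distrib_left)
  also have "\<dots> \<le> fact n * exp (x * t) * exp (y * t\<^sup>2 / 2)"
    using assms by (intro mult_left_mono power_div_fact_le_exp) auto
  finally show ?thesis by (simp add: exp_add mult.assoc)
qed

text \<open>In the induction step the claim reduces to e n^(n+1) \<le> (n+1)^(n+1), which is ln u
  \<le> u - 1 at u = n/(n+1), multiplied by n+1.\<close>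

lemma fact_le_stirling:
  assumes "n \<ge> 1"
  shows "fact n \<le> exp 1 * real n * (real n / exp 1) ^ n"
  using assms
proof (induction n rule: dec_induct)
  case base
  then show ?case by simp
next
  case (step n)
  have n: "real n > 0" using step by simp
  have "ln (real n / real (Suc n)) \<le> real n / real (Suc n) - 1"
    using n by (intro ln_le_minus_one) auto
  also have "\<dots> = - (1 / real (Suc n))"
    using n by (simp add: field_simps)
  finally have "ln (real n / real (Suc n)) * real (Suc n) \<le> -1"
    by (simp add: field_simps)
  then have "exp (ln (real n / real (Suc n)) * real (Suc n)) \<le> exp (-1)"
    by simp
  then have "(real n / real (Suc n)) ^ Suc n \<le> exp (-1)"
    using n by (subst (asm) mult.commute, subst (asm) exp_of_nat_mult) simp
  then have key: "exp 1 * real n ^ Suc n \<le> real (Suc n) ^ Suc n"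
    by (simp add: power_divide exp_minus divide_le_eq inverse_eq_divide pos_le_divide_eq mult.commute del: power_Suc)
  have "fact (Suc n) = real (Suc n) * fact n" by simp
  also have "\<dots> \<le> real (Suc n) * (exp 1 * real n * (real n / exp 1) ^ n)"
    using step by (intro mult_left_mono) auto
  also have "\<dots> = real (Suc n) * (exp 1 * real n ^ Suc n) / exp 1 ^ n"
    by (simp add: power_divide)
  also have "\<dots> \<le> real (Suc n) * (real (Suc n) ^ Suc n) / exp 1 ^ n"
    by (intro mult_left_mono divide_right_mono key) auto
  also have "\<dots> = exp 1 * real (Suc n) * (real (Suc n) / exp 1) ^ Suc n"
    by (simp add: power_divide)
  finally show ?case .
qed

section \<open>Gaussian growth makes the majorant series summable\<close>

lemma summable_gauss_decay:
  fixes c d :: real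
  assumes "d > 0"
  shows "summable (\<lambda>n. real n * exp (c * sqrt (real n) - d * real n))"
proof (rule summable_comparison_test_bigo)
  show "summable (\<lambda>n. norm (1 / real n ^ 2))"
    using inverse_power_summable[of 2, where 'a = real] by (simp add: divide_inverse)
  show "(\<lambda>n. real n * exp (c * sqrt (real n) - d * real n)) \<in> O(\<lambda>n. 1 / real n ^ 2)"
    using assms by real_asymp
qed

lemma gauss_summableI:
  assumes bound: "\<And>n r. r > 0 \<Longrightarrow> norm (a n) * r ^ n \<le> K * exp (b * r\<^sup>2)"
    and b: "b > 0" and y: "0 \<le> y" "2 * b * y < 1"
  shows "gauss_summable a y"
proof -
  \<comment> \<open>The midpoint of \<open>y\<close> and \<open>1 / (2 * b)\<close>: it keeps
    \<open>2 * b * y' < 1\<close> and is positive even for \<open>y = 0\<close>, so that the radius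
    \<open>t\<close> below makes sense.\<close>
  define y' where "y' = (y + 1 / (2 * b)) / 2"
  have y': "y' > 0" "y \<le> y'" "2 * b * y' < 1"
    using b y by (simp_all add: y'_def field_simps add_pos_nonneg)
  define q where "q = 2 * b * y'"
  have q: "0 < q" "q < 1" using b y' by (simp_all add: q_def)
  \<comment> \<open>Chosen so that exp(-d) is the square root of \<open>q\<close>, the geometric
    rate of decay.\<close>
  define d where "d = - ln q / 2"
  have d: "d > 0" using q by (simp add: d_def)
  have K: "K \<ge> 0"
  proof -
    have "0 \<le> norm (a 0) * 1 ^ 0" by simp
    also have "\<dots> \<le> K * exp (b * 1\<^sup>2)" by (rule bound) simp
    finally show ?thesis by (simp add: zero_le_mult_iff)
  qed
  show ?thesis
    unfolding gauss_summable_def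
  proof (intro allI impI)
    fix x :: real
    assume x: "x \<ge> 0"
    define c where "c = x / sqrt y'"
    show "summable (\<lambda>n. norm (a n) * hermite_majorant x y n)"
    proof (rule summable_comparison_test_ev)
      show "summable (\<lambda>n. (K * exp 1) * (real n * exp (c * sqrt (real n) - d * real n)))"
        by (intro summable_mult summable_gauss_decay d)
      have "norm (norm (a n) * hermite_majorant x y n)
          \<le> (K * exp 1) * (real n * exp (c * sqrt (real n) - d * real n))" if n: "n \<ge> 1" for n
      proof -
        \<comment> \<open>These radii optimise Cauchy's estimates up to the lower order term \<open>x * t\<close>.\<close>
        define r where "r = sqrt (real n / (2 * b))"
        define t where "t = sqrt (real n / y')"
        have rt: "r > 0" "t > 0" using n b y' by (simp_all add: r_def t_def)
        have r2: "b * r\<^sup>2 = real n / 2" using b by (simp add: r_def)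
        have t2: "y' * t\<^sup>2 / 2 = real n / 2" using y' by (simp add: t_def)
        have xt: "x * t = c * sqrt (real n)" by (simp add: c_def t_def real_sqrt_divide)
        have "q * (r * t)\<^sup>2 = (real n)\<^sup>2"
          using b y' by (simp add: r_def t_def q_def power_mult_distrib) (simp add: power2_eq_square)
        then have "(r * t)\<^sup>2 = (real n)\<^sup>2 * exp d ^ 2"
          using q by (simp add: d_def field_simps exp_minus flip: exp_of_nat_mult)
        then have "(r * t)\<^sup>2 = (real n * exp d)\<^sup>2"
          by (simp add: power_mult_distrib)
        then have rt_eq: "r * t = real n * exp d"
          using rt by (subst (asm) power2_eq_iff_nonneg) auto
        have "(norm (a n) * hermite_majorant x y n) * (r * t) ^ n
            \<le> (norm (a n) * r ^ n) * (hermite_majorant x y' n * t ^ n)"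
          using hermite_majorant_mono[of x x y y' n] x y y' rt
          by (simp add: power_mult_distrib mult_ac mult_left_mono)
        also have "\<dots> \<le> (K * exp (real n / 2)) * (fact n * exp (c * sqrt (real n) + real n / 2))"
          using bound[of r n] hermite_majorant_le[of x y' t n] x y' rt K
          by (intro mult_mono[of "norm (a n) * r ^ n"]) (auto simp: r2 t2 xt)
        also have "\<dots> = K * exp (real n + c * sqrt (real n)) * fact n"
          by (simp add: exp_add [symmetric] mult_exp_exp algebra_simps)
        \<comment> \<open>The two Cauchy estimates contribute exp(n/2) each; their product cancels
          against the exp(-n) in Stirling's bound, and n^n is absorbed by
          \<open>(r * t) ^ n\<close>.\<close>
        also have "\<dots> \<le> K * exp (real n + c * sqrt (real n))
            * (exp 1 * real n * (real n / exp 1) ^ n)"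
          using K n by (intro mult_left_mono fact_le_stirling) auto
        also have "\<dots> = (K * exp 1) * (real n * exp (c * sqrt (real n) - d * real n)) * (r * t) ^ n"
          by (simp add: rt_eq power_divide power_mult_distrib exp_add exp_diff exp_minus mult_ac
              flip: exp_of_nat_mult)
        finally show ?thesis
          using rt x y by (simp add: mult_le_cancel_right_pos)
      qed
      then show "\<forall>\<^sub>F n in sequentially. norm (norm (a n) * hermite_majorant x y n)
          \<le> (K * exp 1) * (real n * exp (c * sqrt (real n) - d * real n))"
        unfolding eventually_sequentially by blast
    qed
  qed
qed

section \<open>Majorants under differentiation\<close>

lemma power_Suc_ge_derivative:
  fixes x :: real
  assumes "x \<ge> 0"
  shows "real (Suc n) * x ^ n \<le> (x + 1) ^ Suc n"
proof -
  have "real (Suc n) * x ^ n \<le> (\<Sum>k\<le>Suc n. real (Suc n choose k) * x ^ k * 1 ^ (Suc n - k))"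
    using member_le_sum[of n "{..Suc n}" "\<lambda>k. real (Suc n choose k) * x ^ k * 1 ^ (Suc n - k)"] assms
    by simp
  also have "\<dots> = (x + 1) ^ Suc n" by (simp only: binomial_ring)
  finally show ?thesis .
qed

text \<open>By the Appell property, the left side is the \<open>x\<close>-derivative of
  \<open>hermite_majorant x y (Suc n)\<close>. Each derivative of a power \<open>x ^ j\<close> is at
  most \<open>(x + 1) ^ j\<close>, as it is one term of the binomial expansion.\<close>

lemma hermite_majorant_Suc_ge:
  assumes "x \<ge> 0" "y \<ge> 0"
  shows "real (Suc n) * hermite_majorant x y n \<le> hermite_majorant (x + 1) y (Suc n)"
proof -
  have "real (Suc n) * hermite_majorant x y n
      = (\<Sum>m\<le>n div 2. real (Suc n) * (hermite_coeff n m * (y / 2) ^ m * x ^ (n - 2 * m)))"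
    by (simp only: hermite_majorant_def sum_distrib_left)
  also have "\<dots> \<le> (\<Sum>m\<le>n div 2. hermite_coeff (Suc n) m * (y / 2) ^ m * (x + 1) ^ (Suc n - 2 * m))"
  proof (intro sum_mono)
    fix m assume "m \<in> {..n div 2}"
    then have m: "2 * m \<le> n" by simp
    then have Suc: "Suc n - 2 * m = Suc (n - 2 * m)" by simp
    have "real (Suc n) * (hermite_coeff n m * (y / 2) ^ m * x ^ (n - 2 * m))
        = hermite_coeff (Suc n) m * (y / 2) ^ m * (real (Suc (n - 2 * m)) * x ^ (n - 2 * m))"
      using m unfolding hermite_coeff_def Suc by (simp add: field_simps del: of_nat_Suc)
    also have "\<dots> \<le> hermite_coeff (Suc n) m * (y / 2) ^ m * (x + 1) ^ (Suc n - 2 * m)"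
      unfolding Suc using assms
      by (intro mult_left_mono power_Suc_ge_derivative mult_nonneg_nonneg) auto
    finally show "real (Suc n) * (hermite_coeff n m * (y / 2) ^ m * x ^ (n - 2 * m)) \<le> \<dots>" .
  qed
  also have "\<dots> \<le> hermite_majorant (x + 1) y (Suc n)"
    unfolding hermite_majorant_def using assms by (intro sum_mono2) auto
  finally show ?thesis .
qed

text \<open>The factor \<open>Suc n\<close> in \<open>diffs\<close> is paid for by replacing
  \<open>x\<close> with \<open>x + 1\<close>. Since \<open>y\<close> is unchanged, \<open>F'\<close>
  and \<open>F''\<close> admit the same \<open>\<tau>\<close> as \<open>F\<close>.\<close>

lemma gauss_summable_diffs:
  assumes "gauss_summable a y" "y \<ge> 0"
  shows "gauss_summable (diffs a) y"
  unfolding gauss_summable_def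
proof (intro allI impI)
  fix x :: real
  assume x: "x \<ge> 0"
  have "summable (\<lambda>n. norm (a (Suc n)) * hermite_majorant (x + 1) y (Suc n))"
    using assms x unfolding gauss_summable_def by (subst summable_Suc_iff) auto
  then show "summable (\<lambda>n. norm (diffs a n) * hermite_majorant x y n)"
  proof (rule summable_comparison_test[rotated], intro exI allI impI)
    fix n
    have "norm (norm (diffs a n) * hermite_majorant x y n)
        = norm (a (Suc n)) * (real (Suc n) * hermite_majorant x y n)"
      using assms x unfolding diffs_def norm_mult norm_of_nat by (simp del: of_nat_Suc)
    also have "\<dots> \<le> norm (a (Suc n)) * hermite_majorant (x + 1) y (Suc n)"
      using assms x by (intro mult_left_mono hermite_majorant_Suc_ge) auto
    finally show "norm (norm (diffs a n) * hermite_majorant x y n) \<le> \<dots>" .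
  qed
qed

section \<open>Rearranging the double series\<close>

lemma entire_power_series_deriv:
  fixes F :: "complex \<Rightarrow> complex"
  assumes "\<And>z. (\<lambda>n. a n * z ^ n) sums F z"
  shows "(F has_field_derivative deriv F z) (at z)" "(\<lambda>n. diffs a n * z ^ n) sums deriv F z"
proof -
  have sm: "summable (\<lambda>n. a n * w ^ n)" for w using assms sums_summable by blast
  have "F = (\<lambda>w. \<Sum>n. a n * w ^ n)" using assms by (auto simp: sums_iff)
  then have D: "(F has_field_derivative (\<Sum>n. diffs a n * z ^ n)) (at z)"
    using termdiffs_strong_converges_everywhere[OF sm] by simp
  then show "(F has_field_derivative deriv F z) (at z)"
    using DERIV_imp_deriv by force
  show "(\<lambda>n. diffs a n * z ^ n) sums deriv F z"
    using termdiff_converges_all[OF sm] DERIV_imp_deriv[OF D] by (simp add: sums_iff)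
qed

lemma entire_power_series_higher_deriv:
  fixes F :: "complex \<Rightarrow> complex"
  assumes "\<And>z. (\<lambda>n. a n * z ^ n) sums F z"
  shows "(\<lambda>n. (diffs ^^ j) a n * z ^ n) sums (deriv ^^ j) F z"
proof (induction j arbitrary: z)
  case 0
  then show ?case using assms by simp
next
  case (Suc j)
  then show ?case using entire_power_series_deriv(2)[of "(diffs ^^ j) a"] by simp
qed

lemma diffs_funpow:
  fixes a :: "nat \<Rightarrow> 'a::field_char_0"
  shows "(diffs ^^ j) a n = fact (n + j) / fact n * a (n + j)"
proof (induction j arbitrary: n)
  case (Suc j)
  have "of_nat (Suc n) * (fact (Suc n + j) / fact (Suc n)) = (fact (n + Suc j) / fact n :: 'a)"
    by (simp add: divide_simps del: of_nat_Suc)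
  moreover have "(diffs ^^ Suc j) a n = of_nat (Suc n) * (diffs ^^ j) a (Suc n)"
    by (simp add: diffs_def)
  ultimately show ?case by (simp only: Suc.IH mult.assoc [symmetric] add_Suc add_Suc_right)
qed auto

text \<open>Cauchy's inequality at 0; the constant term of the \<open>n\<close> times differentiated
  series identifies the derivative there as n! times \<open>a n\<close>.\<close>

lemma entire_growth_coeff_bound:
  fixes F :: "complex \<Rightarrow> complex"
  assumes sums: "\<And>z. (\<lambda>n. a n * z ^ n) sums F z"
    and r: "r > 0" and B: "\<And>z. norm z = r \<Longrightarrow> norm (F z) \<le> B"
  shows "norm (a n) * r ^ n \<le> B"
proof -
  have hol: "F holomorphic_on S" for S
    unfolding holomorphic_on_def
    using entire_power_series_deriv(1)[OF sums]
    by (meson field_differentiable_at_within field_differentiable_def)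
  have "norm ((deriv ^^ n) F 0) \<le> fact n * B / r ^ n"
    by (rule Cauchy_inequality) (auto intro!: hol holomorphic_on_imp_continuous_on r B)
  moreover have "(\<lambda>k. (diffs ^^ n) a k * 0 ^ k) sums (diffs ^^ n) a 0"
    by (rule powser_sums_zero)
  then have "(deriv ^^ n) F 0 = fact n * a n"
    using entire_power_series_higher_deriv[OF sums, of n 0] by (simp add: diffs_funpow sums_iff)
  ultimately show ?thesis
    using r by (simp add: norm_mult field_simps)
qed

lemma heat_operator_funpow:
  "(heat_operator \<tau> ^^ k) F z = (- (\<tau> / 2)) ^ k * (deriv ^^ (2 * k)) F z"
  if F: "F holomorphic_on UNIV"
proof (induction k arbitrary: z)
  case (Suc k)
  have hol: "(deriv ^^ j) F holomorphic_on UNIV" for j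
    by (intro holomorphic_higher_deriv F) auto
  have d: "(deriv ^^ j) F field_differentiable at w" for j w
    using hol holomorphic_on_imp_differentiable_at by blast
  have "(heat_operator \<tau> ^^ k) F = (\<lambda>w. (- (\<tau> / 2)) ^ k * (deriv ^^ (2 * k)) F w)"
    using Suc by auto
  moreover have "deriv (\<lambda>w. c * (deriv ^^ j) F w) = (\<lambda>w. c * (deriv ^^ Suc j) F w)" for c j
    using d by (auto intro!: deriv_cmult)
  moreover have "(deriv ^^ 2) G = deriv (deriv G)" for G :: "complex \<Rightarrow> complex"
    by (simp add: numeral_2_eq_2)
  ultimately have "(deriv ^^ 2) ((heat_operator \<tau> ^^ k) F)
      = (\<lambda>w. (- (\<tau> / 2)) ^ k * (deriv ^^ Suc (Suc (2 * k))) F w)"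
    by (simp only:)
  moreover have "(heat_operator \<tau> ^^ Suc k) F z
      = - (\<tau> / 2) * (deriv ^^ 2) ((heat_operator \<tau> ^^ k) F) z"
    by (simp add: heat_operator_def)
  ultimately show ?case by simp
qed auto

text \<open>The root enters only through the even powers \<open>s ^ (2 * m) = \<tau> ^ m\<close>, so
  both roots give the same polynomial in \<open>z\<close> and \<open>\<tau>\<close>, and its value
  at \<open>\<tau> = 0\<close> is the continuation \<open>z ^ n\<close>.\<close>

lemma scaled_He_eq:
  assumes "s\<^sup>2 = \<tau>"
  shows "scaled_He s n z
    = (\<Sum>m\<le>n div 2. of_real (hermite_coeff n m) * (- (\<tau> / 2)) ^ m * z ^ (n - 2 * m))"
proof (cases "s = 0")
  case True
  have "(\<Sum>m\<le>n div 2. of_real (hermite_coeff n m) * (- (\<tau> / 2)) ^ m * z ^ (n - 2 * m))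
      = (\<Sum>m\<in>{0}. of_real (hermite_coeff n m) * (- (\<tau> / 2)) ^ m * z ^ (n - 2 * m))"
    using True assms by (intro sum.mono_neutral_right) auto
  then show ?thesis using True by (simp add: scaled_He_def hermite_coeff_def)
next
  case False
  have "s ^ n * (fact n * ((-1) ^ m / (fact m * 2 ^ m) * ((z / s) ^ (n - 2 * m) / fact (n - 2 * m))))
      = of_real (hermite_coeff n m) * (- (\<tau> / 2)) ^ m * z ^ (n - 2 * m)" if "m \<le> n div 2" for m
  proof -
    have m: "2 * m \<le> n" using that by simp
    have "s ^ n = \<tau> ^ m * s ^ (n - 2 * m)"
      using m by (simp flip: assms power_mult power_add)
    moreover have "(- (\<tau> / 2)) ^ m = (-1) ^ m * \<tau> ^ m / 2 ^ m"
      by (metis mult_minus1 power_divide power_mult_distrib times_divide_eq_right)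
    ultimately show ?thesis
      using m False by (simp add: hermite_coeff_def power_divide mult_ac)
  qed
  then show ?thesis
    using False
    by (simp add: scaled_He_def He_def sum_distrib_left atLeast0AtMost)
qed

section \<open>The double series, its rows and its columns\<close>

definition double_term :: "(nat \<Rightarrow> complex) \<Rightarrow> complex \<Rightarrow> complex \<Rightarrow> nat \<Rightarrow> nat \<Rightarrow> complex" where
  "double_term a z \<tau> n m = of_real (hermite_coeff n m) * a n * (- (\<tau> / 2)) ^ m * z ^ (n - 2 * m)"

definition double_bound :: "(nat \<Rightarrow> complex) \<Rightarrow> real \<Rightarrow> real \<Rightarrow> nat \<Rightarrow> nat \<Rightarrow> real" where
  "double_bound a x y n m = hermite_coeff n m * norm (a n) * (y / 2) ^ m * x ^ (n - 2 * m)"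

lemma double_bound_nonneg [simp]: "x \<ge> 0 \<Longrightarrow> y \<ge> 0 \<Longrightarrow> double_bound a x y n m \<ge> 0"
  by (simp add: double_bound_def)

lemma norm_double_term_le:
  assumes "norm z \<le> x" "norm \<tau> \<le> y"
  shows "norm (double_term a z \<tau> n m) \<le> double_bound a x y n m"
proof -
  have "0 \<le> x" "0 \<le> y" using assms norm_ge_zero order_trans by blast+
  then show ?thesis
    using assms
    by (auto simp: double_term_def double_bound_def norm_mult norm_power norm_divide
        intro!: mult_mono power_mono)
qed

lemma double_term_row:
  assumes "s\<^sup>2 = \<tau>"
  shows "(double_term a z \<tau> n has_sum a n * scaled_He s n z) UNIV"
proof (rule has_sum_finite_neutralI)
  show "a n * scaled_He s n z = sum (double_term a z \<tau> n) {..n div 2}"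
    by (simp add: scaled_He_eq[OF assms] double_term_def sum_distrib_left mult_ac)
qed (auto simp: double_term_def hermite_coeff_def)

lemma double_bound_row: "(double_bound a x y n has_sum norm (a n) * hermite_majorant x y n) UNIV"
proof (rule has_sum_finite_neutralI)
  show "norm (a n) * hermite_majorant x y n = sum (double_bound a x y n) {..n div 2}"
    by (simp add: hermite_majorant_def double_bound_def sum_distrib_left mult_ac)
qed (auto simp: double_bound_def hermite_coeff_def)

text \<open>Tonelli: the terms are nonnegative, each row is finite, and the row sums converge by
  \<open>gauss_summable\<close>.\<close>

lemma double_bound_summable:
  assumes "gauss_summable a y" "x \<ge> 0" "y \<ge> 0"
  shows "(\<lambda>(n, m). double_bound a x y n m) summable_on UNIV \<times> UNIV"
proof -
  have inf: "infsum (double_bound a x y n) UNIV = norm (a n) * hermite_majorant x y n" for n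
    using double_bound_row by (rule infsumI)
  have "(\<lambda>n. norm (a n) * hermite_majorant x y n) summable_on UNIV"
    using assms by (subst summable_on_UNIV_nonneg_real_iff) (auto simp: gauss_summable_def)
  then have "(\<lambda>p. norm (double_bound a x y (fst p) (snd p))) summable_on UNIV \<times> UNIV"
    using assms has_sum_imp_summable[OF double_bound_row]
    by (subst Infinite_Sum.abs_summable_on_Sigma_iff) (auto simp: inf)
  then show ?thesis
    using assms by (simp add: case_prod_unfold)
qed

text \<open>Applying D^(2k) termwise to the power series gives column \<open>k\<close> shifted by
  \<open>2 * k\<close>; the shift can be undone because the entries with \<open>n < 2 * k\<close>
  vanish.\<close>

lemma double_term_column:
  assumes sums: "\<And>z. (\<lambda>n. a n * z ^ n) sums F z"
    and F: "F holomorphic_on UNIV"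
  shows "(\<lambda>n. double_term a z \<tau> n k) sums heat_term F k z \<tau>"
proof -
  have "(\<lambda>n. (- (\<tau> / 2)) ^ k / fact k * ((diffs ^^ (2 * k)) a n * z ^ n))
      sums ((- (\<tau> / 2)) ^ k / fact k * (deriv ^^ (2 * k)) F z)"
    by (intro sums_mult entire_power_series_higher_deriv sums)
  moreover have "(- (\<tau> / 2)) ^ k / fact k * ((diffs ^^ (2 * k)) a n * z ^ n)
      = double_term a z \<tau> (n + 2 * k) k" for n
    by (simp add: double_term_def hermite_coeff_def diffs_funpow)
  ultimately have "(\<lambda>n. double_term a z \<tau> (n + 2 * k) k) sums heat_term F k z \<tau>"
    by (simp add: heat_term_def heat_operator_funpow[OF F])
  then show ?thesis
    by (subst (asm) sums_zero_iff_shift) (auto simp: double_term_def hermite_coeff_def)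
qed

text \<open>The column sums of \<open>double_bound\<close> serve as majorants. They are summable
  because a summable nonnegative array may be summed by columns as well as by rows.\<close>

lemma heat_term_majorant:
  assumes sums: "\<And>z. (\<lambda>n. a n * z ^ n) sums F z"
    and F: "F holomorphic_on UNIV"
    and a: "gauss_summable a y" and xy: "x \<ge> 0" "y \<ge> 0"
  obtains M where "summable M"
    "\<And>k z \<tau>. norm z \<le> x \<Longrightarrow> norm \<tau> \<le> y \<Longrightarrow> norm (heat_term F k z \<tau>) \<le> M k"
proof
  define M where "M k = (\<Sum>\<^sub>\<infinity>n. double_bound a x y n k)" for k
  have swap: "(\<lambda>(m, n). double_bound a x y n m) summable_on UNIV \<times> UNIV"
    using double_bound_summable[OF a xy] by (subst (asm) summable_on_swap) auto
  then have "M summable_on UNIV"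
    unfolding M_def using summable_on_Sigma_banach[of "\<lambda>m n. double_bound a x y n m" UNIV "\<lambda>_. UNIV"] by simp
  then show "summable M" by (rule summable_on_imp_summable)
  fix k and z \<tau> :: complex
  assume z: "norm z \<le> x" "norm \<tau> \<le> y"
  have col: "(\<lambda>n. double_bound a x y n k) summable_on UNIV"
    using summable_on_SigmaD1[OF swap, of k] by simp
  then have sm: "summable (\<lambda>n. double_bound a x y n k)" by (rule summable_on_imp_summable)
  have "(\<lambda>n. double_bound a x y n k) sums M k"
    unfolding M_def using has_sum_infsum[OF col] by (rule has_sum_imp_sums)
  moreover have "norm (\<Sum>n. double_term a z \<tau> n k) \<le> (\<Sum>n. double_bound a x y n k)"
    by (rule norm_suminf_le[OF norm_double_term_le[OF z] sm])
  ultimately show "norm (heat_term F k z \<tau>) \<le> M k"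
    using double_term_column[OF sums F, of z \<tau> k] by (simp add: sums_iff)
qed

lemma norm_scaled_He_le:
  assumes "s\<^sup>2 = \<tau>" "norm z \<le> x" "norm \<tau> \<le> y"
  shows "norm (a n * scaled_He s n z) \<le> norm (a n) * hermite_majorant x y n"
proof -
  have "norm (a n * scaled_He s n z) = norm (\<Sum>m\<le>n div 2. double_term a z \<tau> n m)"
    by (simp add: scaled_He_eq[OF assms(1)] double_term_def sum_distrib_left mult_ac)
  also have "\<dots> \<le> (\<Sum>m\<le>n div 2. double_bound a x y n m)"
    by (intro sum_norm_le norm_double_term_le assms)
  also have "\<dots> = norm (a n) * hermite_majorant x y n"
    by (simp add: hermite_majorant_def double_bound_def sum_distrib_left mult_ac)
  finally show ?thesis .
qed

text \<open>Fubini for an absolutely summable array: the row sums form the Hermite series, the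
  column sums the heat series.\<close>

lemma hermite_series_sums_heat_series:
  assumes sums: "\<And>z. (\<lambda>n. a n * z ^ n) sums F z"
    and F: "F holomorphic_on UNIV"
    and a: "gauss_summable a (norm \<tau>)" and s: "s\<^sup>2 = \<tau>"
  shows "(\<lambda>n. a n * scaled_He s n z) sums (\<Sum>k. heat_term F k z \<tau>)"
proof -
  have abs: "(\<lambda>(n, m). norm (double_term a z \<tau> n m)) summable_on UNIV \<times> UNIV"
    using Infinite_Sum.abs_summable_on_comparison_test'[OF double_bound_summable[OF a, of "norm z"],
        of "\<lambda>(n, m). double_term a z \<tau> n m"] norm_double_term_le
    by (auto simp: case_prod_unfold)
  then have sm: "(\<lambda>(n, m). double_term a z \<tau> n m) summable_on UNIV \<times> UNIV"
    using abs_summable_summable[of "\<lambda>(n, m). double_term a z \<tau> n m"] by (simp add: case_prod_unfold)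
  then have sm': "(\<lambda>(m, n). double_term a z \<tau> n m) summable_on UNIV \<times> UNIV"
    by (subst (asm) summable_on_swap) auto
  have row: "(\<Sum>\<^sub>\<infinity>m. double_term a z \<tau> n m) = a n * scaled_He s n z" for n
    using double_term_row[OF s] by (rule infsumI)
  \<comment> \<open>The unconditional sum of a column is also its sequential sum, so it agrees with
    the limit found in \<open>double_term_column\<close>.\<close>
  have col: "(\<Sum>\<^sub>\<infinity>n. double_term a z \<tau> n k) = heat_term F k z \<tau>" for k
  proof -
    have "(\<lambda>n. double_term a z \<tau> n k) summable_on UNIV"
      using summable_on_SigmaD1[OF sm', of k] by simp
    then have "(\<lambda>n. double_term a z \<tau> n k) sums (\<Sum>\<^sub>\<infinity>n. double_term a z \<tau> n k)"
      using has_sum_infsum has_sum_imp_sums by blast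
    then show ?thesis using double_term_column[OF sums F] sums_unique2 by blast
  qed
  have rows: "(\<lambda>n. a n * scaled_He s n z) summable_on UNIV"
    using summable_on_Sigma_banach[of "\<lambda>n m. double_term a z \<tau> n m" UNIV "\<lambda>_. UNIV"] sm
    by (simp add: row)
  have cols: "(\<lambda>k. heat_term F k z \<tau>) summable_on UNIV"
    using summable_on_Sigma_banach[of "\<lambda>m n. double_term a z \<tau> n m" UNIV "\<lambda>_. UNIV"] sm'
    by (simp add: col)
  have "(\<Sum>\<^sub>\<infinity>n. a n * scaled_He s n z) = (\<Sum>\<^sub>\<infinity>k. heat_term F k z \<tau>)"
    using infsum_swap_banach[OF sm] by (simp add: row col)
  also have "\<dots> = (\<Sum>k. heat_term F k z \<tau>)"
    using has_sum_imp_sums[OF has_sum_infsum[OF cols]] by (simp add: sums_iff)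
  finally show ?thesis
    using has_sum_imp_sums[OF has_sum_infsum[OF rows]] by simp
qed

section \<open>Holomorphy in both variables\<close>

lemma has_derivative_product_of_coordinates:
  fixes f g :: "complex \<Rightarrow> complex"
  assumes f: "(f has_field_derivative f') (at z)" and g: "(g has_field_derivative g') (at \<tau>)"
  shows "((\<lambda>p. g (snd p) * f (fst p)) has_derivative (\<lambda>(h, l). g \<tau> * f' * h + g' * f z * l))
    (at (z, \<tau>))"
proof -
  have "((\<lambda>p. f (fst p)) has_derivative (\<lambda>q. f' * fst q)) (at (z, \<tau>))"
    by (rule has_derivative_compose[of fst fst, simplified])
      (use f in \<open>auto simp: has_field_derivative_def intro!: derivative_eq_intros\<close>)
  moreover have "((\<lambda>p. g (snd p)) has_derivative (\<lambda>q. g' * snd q)) (at (z, \<tau>))"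
    by (rule has_derivative_compose[of snd snd, simplified])
      (use g in \<open>auto simp: has_field_derivative_def intro!: derivative_eq_intros\<close>)
  ultimately show ?thesis
    by (auto intro!: derivative_eq_intros simp: algebra_simps case_prod_unfold)
qed

text \<open>
  The heat flow commutes with \<open>\<partial>\<^sub>z\<close>, and differentiating it in \<open>\<tau>\<close> amounts to applying
  \<open>- D\<^sup>2 / 2\<close>, which shifts the index.
\<close>

definition heat_term_dtau :: "(complex \<Rightarrow> complex) \<Rightarrow> nat \<Rightarrow> complex \<Rightarrow> complex \<Rightarrow> complex" where
  "heat_term_dtau F k z \<tau>
    = (case k of 0 \<Rightarrow> 0 | Suc j \<Rightarrow> - 1 / 2 * heat_term (deriv (deriv F)) j z \<tau>)"

lemma heat_term_has_derivative:
  assumes F: "F holomorphic_on UNIV"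
  shows "((\<lambda>p. heat_term F k (fst p) (snd p)) has_derivative
    (\<lambda>(h, l). heat_term (deriv F) k z \<tau> * h + heat_term_dtau F k z \<tau> * l)) (at (z, \<tau>))"
proof -
  have F': "deriv F holomorphic_on UNIV" "deriv (deriv F) holomorphic_on UNIV"
    by (auto intro!: holomorphic_deriv F)
  have "(deriv ^^ (2 * k)) F holomorphic_on UNIV"
    by (intro holomorphic_higher_deriv F) auto
  then have f: "((deriv ^^ (2 * k)) F has_field_derivative (deriv ^^ Suc (2 * k)) F z) (at z)"
    using holomorphic_derivI[of _ UNIV z] by simp
  define g where "g = (\<lambda>w::complex. (- (w / 2)) ^ k / fact k)"
  \<comment> \<open>The derivative of \<open>g\<close> at \<open>\<tau>\<close>: for
    \<open>k = Suc j\<close> the factor \<open>Suc j\<close> from the power rule cancels against the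
    factorial.\<close>
  define g' where "g' = (case k of 0 \<Rightarrow> 0 | Suc j \<Rightarrow> - 1 / 2 * ((- (\<tau> / 2)) ^ j / fact j))"
  have g: "(g has_field_derivative g') (at \<tau>)"
  proof (cases k)
    case (Suc j)
    have "((\<lambda>w. - (w / 2)) has_field_derivative - 1 / 2) (at \<tau>)"
      by (auto intro!: derivative_eq_intros)
    from DERIV_cdivide[OF DERIV_power[OF this, of "Suc j"], of "fact (Suc j)"]
    have "(g has_field_derivative of_nat (Suc j) * (- 1 / 2 * (- (\<tau> / 2)) ^ j) / fact (Suc j)) (at \<tau>)"
      by (simp add: g_def Suc del: of_nat_Suc fact_Suc)
    moreover have "of_nat (Suc j) * (- 1 / 2 * (- (\<tau> / 2)) ^ j) / fact (Suc j) = g'"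
      by (simp add: g'_def Suc divide_simps del: of_nat_Suc)
    ultimately show ?thesis by simp
  qed (simp add: g_def g'_def)
  have "(\<lambda>p. heat_term F k (fst p) (snd p)) = (\<lambda>p. g (snd p) * (deriv ^^ (2 * k)) F (fst p))"
    by (auto simp: heat_term_def heat_operator_funpow[OF F] g_def)
  moreover have "heat_term (deriv F) k z \<tau> = g \<tau> * (deriv ^^ Suc (2 * k)) F z"
    unfolding heat_term_def heat_operator_funpow[OF F'(1)] funpow_Suc_right by (simp add: g_def)
  moreover have "heat_term_dtau F k z \<tau> = g' * (deriv ^^ (2 * k)) F z"
  proof (cases k)
    case (Suc j)
    have "(deriv ^^ (2 * j)) (deriv (deriv F)) = (deriv ^^ (2 * k)) F"
      by (simp add: Suc funpow_swap1)
    then show ?thesis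
      by (simp add: heat_term_dtau_def heat_term_def heat_operator_funpow[OF F'(2)] Suc g'_def)
  qed (simp add: heat_term_dtau_def g'_def)
  ultimately show ?thesis
    using has_derivative_product_of_coordinates[OF f g] by simp
qed

text \<open>Termwise differentiation on an open convex product of balls. The partial derivatives are
  heat series of \<open>F'\<close> and, up to a factor and an index shift, of \<open>F''\<close>, so
  their majorants give the uniform convergence needed.\<close>

lemma heat_series_has_derivative:
  assumes sums: "\<And>z. (\<lambda>n. a n * z ^ n) sums F z"
    and F: "F holomorphic_on UNIV"
    and a: "gauss_summable a y" and \<tau>: "norm \<tau> < y"
  shows "\<exists>A B. ((\<lambda>p. \<Sum>k. heat_term F k (fst p) (snd p)) has_derivative (\<lambda>(h, l). A * h + B * l))
    (at (z, \<tau>))"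
proof -
  \<comment> \<open>Any radius above \<open>norm z\<close> would do: together with
    \<open>norm \<tau> < y\<close> it makes \<open>(z, \<tau>)\<close> an interior point of
    \<open>S\<close>.\<close>
  define x where "x = norm z + 1"
  have xy: "x \<ge> 0" "y \<ge> 0" using order_trans[OF norm_ge_zero less_imp_le[OF \<tau>]] by (auto simp: x_def)
  have F': "deriv F holomorphic_on UNIV" "deriv (deriv F) holomorphic_on UNIV"
    by (auto intro!: holomorphic_deriv F)
  have sums': "(\<lambda>n. diffs a n * z ^ n) sums deriv F z" for z
    by (rule entire_power_series_deriv[OF sums])
  have sums'': "(\<lambda>n. diffs (diffs a) n * z ^ n) sums deriv (deriv F) z" for z
    by (rule entire_power_series_deriv[OF sums'])
  note a' = gauss_summable_diffs[OF a xy(2)]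
  obtain M0 where M0: "summable M0"
    "\<And>k z \<tau>. norm z \<le> x \<Longrightarrow> norm \<tau> \<le> y \<Longrightarrow> norm (heat_term F k z \<tau>) \<le> M0 k"
    using heat_term_majorant[OF sums F a xy] by blast
  obtain M1 where M1: "summable M1"
    "\<And>k z \<tau>. norm z \<le> x \<Longrightarrow> norm \<tau> \<le> y \<Longrightarrow> norm (heat_term (deriv F) k z \<tau>) \<le> M1 k"
    using heat_term_majorant[OF sums' F'(1) a' xy] by blast
  obtain M2 where M2: "summable M2"
    "\<And>k z \<tau>. norm z \<le> x \<Longrightarrow> norm \<tau> \<le> y \<Longrightarrow> norm (heat_term (deriv (deriv F)) k z \<tau>) \<le> M2 k"
    using heat_term_majorant[OF sums'' F'(2) gauss_summable_diffs[OF a' xy(2)] xy] by blast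
  define S where "S = ball (0::complex) x \<times> ball (0::complex) y"
  have S: "convex S" "open S" "(z, \<tau>) \<in> S"
    using \<tau> by (auto simp: S_def x_def intro: convex_Times open_Times)
  have S_le: "norm (fst p) \<le> x" "norm (snd p) \<le> y" if "p \<in> S" for p
    using that by (auto simp: S_def)
  define D1 where "D1 k p = heat_term (deriv F) k (fst p) (snd p)" for k p
  define D2 where "D2 k p = heat_term_dtau F k (fst p) (snd p)" for k p
  have U1: "uniform_limit S (\<lambda>n p. \<Sum>k<n. D1 k p) (\<lambda>p. \<Sum>k. D1 k p) sequentially"
    by (rule Weierstrass_m_test[OF _ M1(1)]) (auto simp: D1_def intro!: M1 S_le)
  have U2: "uniform_limit S (\<lambda>n p. \<Sum>k<n. D2 k p) (\<lambda>p. \<Sum>k. D2 k p) sequentially"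
  proof (rule Weierstrass_m_test)
    show "summable (case_nat 0 (\<lambda>k. M2 k / 2))"
      by (subst summable_Suc_iff [symmetric]) (simp add: M2 summable_divide)
    show "norm (D2 k p) \<le> case_nat 0 (\<lambda>k. M2 k / 2) k" if "p \<in> S" for k p
      using M2(2)[OF S_le[OF that]]
      by (auto simp: D2_def heat_term_dtau_def norm_mult norm_divide split: nat.split)
  qed
  have "\<exists>g. \<forall>p\<in>S. (\<lambda>k. heat_term F k (fst p) (snd p)) sums g p
      \<and> (g has_derivative (\<lambda>q. (\<Sum>k. D1 k p) * fst q + (\<Sum>k. D2 k p) * snd q)) (at p within S)"
  proof (rule has_derivative_series[OF S(1) _ _ S(3)])
    fix k p
    show "((\<lambda>p. heat_term F k (fst p) (snd p)) has_derivative
        (\<lambda>q. D1 k p * fst q + D2 k p * snd q)) (at p within S)"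
      using heat_term_has_derivative[OF F, of k "fst p" "snd p"]
      by (simp add: D1_def D2_def case_prod_unfold has_derivative_at_withinI)
  next
    fix e :: real assume e: "e > 0"
    have "\<forall>\<^sub>F n in sequentially. \<forall>p\<in>S. dist (\<Sum>k<n. D1 k p) (\<Sum>k. D1 k p) < e / 2"
      "\<forall>\<^sub>F n in sequentially. \<forall>p\<in>S. dist (\<Sum>k<n. D2 k p) (\<Sum>k. D2 k p) < e / 2"
      using uniform_limitD[OF U1, of "e / 2"] uniform_limitD[OF U2, of "e / 2"] e by simp_all
    then show "\<forall>\<^sub>F n in sequentially. \<forall>p\<in>S. \<forall>q. norm ((\<Sum>k<n. D1 k p * fst q + D2 k p * snd q)
        - ((\<Sum>k. D1 k p) * fst q + (\<Sum>k. D2 k p) * snd q)) \<le> e * norm q"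
    proof eventually_elim
      case (elim n)
      show ?case
      proof (intro ballI allI)
        fix p and q :: "complex \<times> complex"
        assume p: "p \<in> S"
        have "(\<Sum>k<n. D1 k p * fst q + D2 k p * snd q)
            - ((\<Sum>k. D1 k p) * fst q + (\<Sum>k. D2 k p) * snd q)
            = ((\<Sum>k<n. D1 k p) - (\<Sum>k. D1 k p)) * fst q + ((\<Sum>k<n. D2 k p) - (\<Sum>k. D2 k p)) * snd q"
          by (simp add: sum.distrib left_diff_distrib flip: sum_distrib_right)
        \<comment> \<open>Each coordinate of \<open>q\<close> is bounded by \<open>norm q\<close>,
          so half of \<open>e\<close> goes to each partial derivative.\<close>
        also have "norm \<dots> \<le> e / 2 * norm q + e / 2 * norm q"
        proof (intro norm_triangle_mono)
          show "norm (((\<Sum>k<n. D1 k p) - (\<Sum>k. D1 k p)) * fst q) \<le> e / 2 * norm q"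
            unfolding norm_mult using elim(1) p e norm_fst_le[of "fst q" "snd q"]
            by (intro mult_mono) (simp_all add: dist_norm less_imp_le)
          show "norm (((\<Sum>k<n. D2 k p) - (\<Sum>k. D2 k p)) * snd q) \<le> e / 2 * norm q"
            unfolding norm_mult using elim(2) p e norm_snd_le[of "snd q" "fst q"]
            by (intro mult_mono) (simp_all add: dist_norm less_imp_le)
        qed
        finally show "norm ((\<Sum>k<n. D1 k p * fst q + D2 k p * snd q)
            - ((\<Sum>k. D1 k p) * fst q + (\<Sum>k. D2 k p) * snd q)) \<le> e * norm q"
          by simp
      qed
    qed
  next
    show "(\<lambda>k. heat_term F k (fst (z, \<tau>)) (snd (z, \<tau>))) sums (\<Sum>k. heat_term F k z \<tau>)"
      using summable_comparison_test'[OF M0(1), of 0 "\<lambda>k. heat_term F k z \<tau>"] M0(2) S_le[OF S(3)]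
      by (auto intro: summable_sums)
  qed
  then obtain g where g: "\<And>p. p \<in> S \<Longrightarrow> (\<lambda>k. heat_term F k (fst p) (snd p)) sums g p"
    "\<And>p. p \<in> S \<Longrightarrow>
      (g has_derivative (\<lambda>q. (\<Sum>k. D1 k p) * fst q + (\<Sum>k. D2 k p) * snd q)) (at p within S)"
    by blast
  \<comment> \<open>Since \<open>S\<close> is open, the derivative within \<open>S\<close> is a full
    derivative, and \<open>g\<close> agrees with the heat series on all of \<open>S\<close>.\<close>
  have "(g has_derivative (\<lambda>q. (\<Sum>k. D1 k (z, \<tau>)) * fst q + (\<Sum>k. D2 k (z, \<tau>)) * snd q)) (at (z, \<tau>))"
    using g(2)[OF S(3)] at_within_open[OF S(3,2)] by simp
  then have "((\<lambda>p. \<Sum>k. heat_term F k (fst p) (snd p)) has_derivative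
      (\<lambda>q. (\<Sum>k. D1 k (z, \<tau>)) * fst q + (\<Sum>k. D2 k (z, \<tau>)) * snd q)) (at (z, \<tau>))"
    using S(2,3) by (rule has_derivative_transform_within_open) (use g(1) in \<open>simp add: sums_iff\<close>)
  then show ?thesis unfolding case_prod_unfold by blast
qed

section \<open>Absolute and uniform convergence on polydiscs\<close>

lemma abs_uniformly_summable_onI:
  assumes "summable M" "\<And>n p. p \<in> K \<Longrightarrow> norm (f n p) \<le> M n"
  shows "abs_uniformly_summable_on f K"
  unfolding abs_uniformly_summable_on_def using assms by (auto intro!: Weierstrass_m_test'[of _ _ M])

text \<open>Summability is assumed only for \<open>y \<ge> 0\<close> since in situation (S2) the
  constant \<open>C2\<close> may be negative; the polydisc is then empty.\<close>

lemma abs_uniformly_summable_heat: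
  assumes sums: "\<And>z. (\<lambda>n. a n * z ^ n) sums F z"
    and F: "F holomorphic_on UNIV"
    and a: "y \<ge> 0 \<Longrightarrow> gauss_summable a y" and x: "x \<ge> 0"
  shows "abs_uniformly_summable_on (\<lambda>k (z, \<tau>). heat_term F k z \<tau>) (cball 0 x \<times> cball 0 y)"
proof (cases "y \<ge> 0")
  case True
  obtain M where "summable M"
    "\<And>k z \<tau>. norm z \<le> x \<Longrightarrow> norm \<tau> \<le> y \<Longrightarrow> norm (heat_term F k z \<tau>) \<le> M k"
    using heat_term_majorant[OF sums F a[OF True] x True] by blast
  then show ?thesis by (intro abs_uniformly_summable_onI) auto
next
  case False
  then show ?thesis by (intro abs_uniformly_summable_onI[of "\<lambda>_. 0"]) auto
qed

text \<open>The majorant is independent of the root, so \<open>sq\<close> may select roots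
  arbitrarily, without any continuity.\<close>

lemma abs_uniformly_summable_hermite:
  assumes a: "y \<ge> 0 \<Longrightarrow> gauss_summable a y" and x: "x \<ge> 0"
    and sq: "\<And>\<tau>. (sq \<tau>)\<^sup>2 = \<tau>"
  shows "abs_uniformly_summable_on (\<lambda>n (z, \<tau>). a n * scaled_He (sq \<tau>) n z) (cball 0 x \<times> cball 0 y)"
proof (cases "y \<ge> 0")
  case True
  then show ?thesis
    using a x norm_scaled_He_le[OF sq]
    by (intro abs_uniformly_summable_onI[of "\<lambda>n. norm (a n) * hermite_majorant x y n"])
      (auto simp: gauss_summable_def)
next
  case False
  then show ?thesis by (intro abs_uniformly_summable_onI[of "\<lambda>_. 0"]) auto
qed

section \<open>Order and type\<close>

text \<open>A real supremum bounds its members only if the set is bounded above, which compactness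
  of the circle provides.\<close>

lemma norm_le_max_modulus:
  assumes "F holomorphic_on UNIV"
  shows "norm (F z) \<le> max_modulus F (norm z)"
  unfolding max_modulus_def
proof (rule cSUP_upper)
  have "continuous_on (sphere 0 (norm z)) (\<lambda>z. norm (F z))"
    using assms by (intro continuous_intros holomorphic_on_imp_continuous_on) (rule holomorphic_on_subset, auto)
  then show "bdd_above ((\<lambda>z. norm (F z)) ` sphere 0 (norm z))"
    by (intro bounded_imp_bdd_above compact_imp_bounded compact_continuous_image) auto
qed auto

lemma gaussian_growth_bound:
  assumes F: "F holomorphic_on UNIV" and b: "b \<ge> 0"
    and ev: "\<forall>\<^sub>F r in at_top. max_modulus F r \<le> exp (b * r\<^sup>2)"
  obtains K where "\<And>z. norm (F z) \<le> K * exp (b * (norm z)\<^sup>2)"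
proof -
  obtain R where R: "\<And>r. r \<ge> R \<Longrightarrow> max_modulus F r \<le> exp (b * r\<^sup>2)"
    using ev unfolding eventually_at_top_linorder by blast
  have "continuous_on (cball 0 R) F"
    using F holomorphic_on_imp_continuous_on continuous_on_subset by blast
  then have "bounded (F ` cball 0 R)"
    by (intro compact_imp_bounded compact_continuous_image) auto
  then obtain K where "\<forall>z\<in>cball 0 R. norm (F z) \<le> K"
    unfolding bounded_iff by auto
  then have K: "norm (F z) \<le> K" if "norm z \<le> R" for z using that by simp
  show ?thesis
  proof (rule that)
    fix z
    \<comment> \<open>\<open>K\<close> handles the disc of radius \<open>R\<close>, where the
      exponential is at least 1; the constant 1 suffices outside.\<close>
    show "norm (F z) \<le> max 1 K * exp (b * (norm z)\<^sup>2)"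
    proof (cases "norm z \<le> R")
      case True
      have "norm (F z) \<le> max 1 K * 1" using K[OF True] by simp
      also have "\<dots> \<le> max 1 K * exp (b * (norm z)\<^sup>2)" using b by (intro mult_left_mono) auto
      finally show ?thesis .
    next
      case False
      have "norm (F z) \<le> 1 * exp (b * (norm z)\<^sup>2)"
        using norm_le_max_modulus[OF F, of z] R[of "norm z"] False by simp
      also have "\<dots> \<le> max 1 K * exp (b * (norm z)\<^sup>2)" by (intro mult_right_mono) auto
      finally show ?thesis .
    qed
  qed
qed

text \<open>For (S1) every \<open>b > 0\<close> is a growth constant, since r^\<mu> = o(r^2) for
  some admissible \<mu> < 2. For (S2) any \<open>b\<close> above the type is one, and 2 \<sigma> y <
  1 leaves room for such a \<open>b\<close>.\<close>

lemma situation_growth: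
  assumes "situation_S1 F \<or> situation_S2 F" and y: "y \<ge> 0"
    and tb: "situation_S2 F \<Longrightarrow> ereal y < tau_bound F"
  obtains b where "b > 0" "2 * b * y < 1" "\<forall>\<^sub>F r in at_top. max_modulus F r \<le> exp (b * r\<^sup>2)"
  using assms(1)
proof
  assume "situation_S1 F"
  then have "entire_order F < 2" by (simp add: situation_S1_def)
  then obtain \<mu> where \<mu>: "ereal \<mu> < 2" "\<forall>\<^sub>F r in at_top. max_modulus F r < exp (r powr \<mu>)"
    unfolding entire_order_def Inf_less_iff by auto
  have "\<mu> < 2" using \<mu>(1) by (simp)
  define b where "b = 1 / (2 * (y + 1))"
  have b: "b > 0" "2 * b * y < 1" using y by (simp_all add: b_def field_simps)
  have "\<forall>\<^sub>F r in at_top. r powr \<mu> \<le> b * r\<^sup>2" using \<open>\<mu> < 2\<close> b(1) by real_asymp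
  with \<mu>(2) have "\<forall>\<^sub>F r in at_top. max_modulus F r \<le> exp (b * r\<^sup>2)"
    by eventually_elim (meson exp_le_cancel_iff less_imp_le order_trans)
  with b show thesis by (rule that)
next
  assume S2: "situation_S2 F"
  then have ord: "entire_order F = 2" and fin: "entire_type F < \<infinity>"
    by (auto simp: situation_S2_def)
  have "entire_type F \<ge> 0" unfolding entire_type_def by (rule Inf_greatest) auto
  with fin obtain t where t: "entire_type F = ereal t" "t \<ge> 0"
    by (cases "entire_type F") auto
  have ty: "2 * t * y < 1"
  \<comment> \<open>Type 0 is separate: \<open>tau_bound\<close> is then infinite by convention and
    the inequality is trivial.\<close>
  proof (cases "t = 0")
    case False
    then have "tau_bound F = ereal (1 / (2 * t))"
      using t by (simp add: tau_bound_def one_ereal_def)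
    then show ?thesis using tb[OF S2] t False by (simp add: field_simps)
  qed simp
  \<comment> \<open>Raises the type \<open>t\<close> by so little that \<open>2 * b * y\<close> uses
    only the fraction \<open>y / (2 * y + 1)\<close> of the gap \<open>1 - 2 * t * y\<close>; the
    denominator also allows \<open>y = 0\<close>.\<close>
  define b where "b = t + (1 - 2 * t * y) / (2 * (2 * y + 1))"
  have bt: "b > t" using ty y by (simp add: b_def)
  have "2 * b * y = 2 * t * y + (1 - 2 * t * y) * (y / (2 * y + 1))"
    using y by (simp add: b_def field_simps)
  also have "\<dots> < 2 * t * y + (1 - 2 * t * y) * 1"
    using ty y by (intro add_strict_left_mono mult_strict_left_mono) auto
  finally have b: "b > 0" "2 * b * y < 1" using bt t by auto
  have "entire_type F < ereal b" using bt t by simp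
  then obtain c where c: "c < b"
    "\<forall>\<^sub>F r in at_top. max_modulus F r \<le> exp (c * r powr real_of_ereal (entire_order F))"
    unfolding entire_type_def Inf_less_iff by auto
  have "\<forall>\<^sub>F r in at_top. max_modulus F r \<le> exp (b * r\<^sup>2)"
    \<comment> \<open>Positivity of \<open>r\<close> identifies \<open>r powr 2\<close> with
      \<open>r\<^sup>2\<close>.\<close>
    using c(2) eventually_gt_at_top[of "0::real"]
  proof eventually_elim
    case (elim r)
    have "c * r powr real_of_ereal (entire_order F) \<le> b * r\<^sup>2"
      using c(1) elim(2) by (simp add: ord mult_right_mono)
    then show ?case using elim(1) by (meson exp_le_cancel_iff order_trans)
  qed
  with b show thesis by (rule that)
qed

lemma situation_gauss_summable:
  assumes sums: "\<And>z. (\<lambda>n. a n * z ^ n) sums F z"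
    and F: "situation_S1 F \<or> situation_S2 F" and y: "y \<ge> 0"
    and tb: "situation_S2 F \<Longrightarrow> ereal y < tau_bound F"
  shows "gauss_summable a y"
proof -
  have hol: "F holomorphic_on UNIV"
    using F by (auto simp: situation_S1_def situation_S2_def)
  obtain b where b: "b > 0" "2 * b * y < 1" "\<forall>\<^sub>F r in at_top. max_modulus F r \<le> exp (b * r\<^sup>2)"
    using situation_growth[OF F y tb] by blast
  obtain K where K: "\<And>z. norm (F z) \<le> K * exp (b * (norm z)\<^sup>2)"
    using gaussian_growth_bound[OF hol _ b(3)] b(1) by auto
  show ?thesis
  proof (rule gauss_summableI[OF _ b(1) y b(2)])
    show "norm (a n) * r ^ n \<le> K * exp (b * r\<^sup>2)" if "r > 0" for n r
      using K by (intro entire_growth_coeff_bound[OF sums that]) metis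
  qed
qed

lemma open_tau_domain: "open {\<tau> :: complex. ereal (norm \<tau>) < B}"
  by (intro open_Collect_less continuous_on_ereal continuous_intros)

section \<open>Assembling the convergence and holomorphy claims\<close>

theorem theorem2p2:
  fixes F :: "complex \<Rightarrow> complex" and a :: "nat \<Rightarrow> complex"
  assumes "\<And>z. (\<lambda>n. a n * z ^ n) sums F z"
    and "situation_S1 F \<or> situation_S2 F"
  shows
    "(\<forall>\<tau>. (situation_S2 F \<longrightarrow> ereal (norm \<tau>) < tau_bound F) \<longrightarrow>
        (\<forall>z. \<exists>L. (\<lambda>k. heat_term F k z \<tau>) sums L \<and>
             (\<forall>s. s ^ 2 = \<tau> \<longrightarrow> (\<lambda>n. a n * scaled_He s n z) sums L)))
     \<and>
     (situation_S1 F \<longrightarrow> (\<forall>C1 > 0. \<forall>C2 > 0.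
        abs_uniformly_summable_on (\<lambda>k (z, \<tau>). heat_term F k z \<tau>) (cball 0 C1 \<times> cball 0 C2) \<and>
        (\<forall>sq. (\<forall>\<tau>. sq \<tau> ^ 2 = \<tau>) \<longrightarrow>
           abs_uniformly_summable_on (\<lambda>n (z, \<tau>). a n * scaled_He (sq \<tau>) n z)
             (cball 0 C1 \<times> cball 0 C2))))
     \<and>
     (situation_S2 F \<longrightarrow> (\<forall>C1 > 0. \<forall>C2. ereal C2 < tau_bound F \<longrightarrow>
        abs_uniformly_summable_on (\<lambda>k (z, \<tau>). heat_term F k z \<tau>) (cball 0 C1 \<times> cball 0 C2) \<and>
        (\<forall>sq. (\<forall>\<tau>. sq \<tau> ^ 2 = \<tau>) \<longrightarrow>
           abs_uniformly_summable_on (\<lambda>n (z, \<tau>). a n * scaled_He (sq \<tau>) n z)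
             (cball 0 C1 \<times> cball 0 C2))))
     \<and>
     (\<exists>G. (situation_S1 F \<longrightarrow> holomorphic2_on G UNIV) \<and>
          (situation_S2 F \<longrightarrow> holomorphic2_on G (UNIV \<times> {\<tau>. ereal (norm \<tau>) < tau_bound F})) \<and>
          (\<forall>z \<tau>. (situation_S2 F \<longrightarrow> ereal (norm \<tau>) < tau_bound F) \<longrightarrow>
             (\<lambda>k. heat_term F k z \<tau>) sums G (z, \<tau>) \<and>
             (\<forall>s. s ^ 2 = \<tau> \<longrightarrow> (\<lambda>n. a n * scaled_He s n z) sums G (z, \<tau>))))"
proof -
  define G where "G p = (\<Sum>k. heat_term F k (fst p) (snd p))" for p
  note sums = assms(1)
  \<comment> \<open>The orders exclude each other, so under (S1) the restriction on
    \<open>\<tau>\<close> is vacuous and every \<open>y \<ge> 0\<close> is allowed in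
    \<open>gs\<close>.\<close>
  have hol: "F holomorphic_on UNIV" and excl: "situation_S1 F \<Longrightarrow> \<not> situation_S2 F"
    using assms(2) by (auto simp: situation_S1_def situation_S2_def)
  note gs = situation_gauss_summable[OF sums assms(2)]
  have conv: "(\<lambda>k. heat_term F k z \<tau>) sums G (z, \<tau>)"
      "\<And>s. s\<^sup>2 = \<tau> \<Longrightarrow> (\<lambda>n. a n * scaled_He s n z) sums G (z, \<tau>)"
    if "situation_S2 F \<longrightarrow> ereal (norm \<tau>) < tau_bound F" for z \<tau>
  proof -
    have a: "gauss_summable a (norm \<tau>)" using that by (intro gs) simp_all
    obtain M where "summable M"
      "\<And>k w t. norm w \<le> norm z \<Longrightarrow> norm t \<le> norm \<tau> \<Longrightarrow> norm (heat_term F k w t) \<le> M k"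
      using heat_term_majorant[OF sums hol a norm_ge_zero norm_ge_zero] by blast
    then have "summable (\<lambda>k. heat_term F k z \<tau>)"
      using summable_comparison_test'[of M 0 "\<lambda>k. heat_term F k z \<tau>"] by auto
    then show "(\<lambda>k. heat_term F k z \<tau>) sums G (z, \<tau>)"
      by (simp add: G_def summable_sums)
    show "(\<lambda>n. a n * scaled_He s n z) sums G (z, \<tau>)" if "s\<^sup>2 = \<tau>" for s
      using hermite_series_sums_heat_series[OF sums hol a that] by (simp add: G_def)
  qed
  have holG: "\<exists>A B. (G has_derivative (\<lambda>(h, k). A * h + B * k)) (at (z, \<tau>))"
    if "gauss_summable a y" "norm \<tau> < y" for z \<tau> y
    using heat_series_has_derivative[OF sums hol that] by (simp add: G_def [abs_def])
  have G1: "holomorphic2_on G UNIV" if "situation_S1 F"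
  proof -
    have "\<exists>A B. (G has_derivative (\<lambda>(h, k). A * h + B * k)) (at (z, \<tau>))" for z \<tau>
      by (rule holG[OF gs[of "norm \<tau> + 1"]]) (use excl[OF that] in simp_all)
    then show ?thesis by (auto simp: holomorphic2_on_def)
  qed
  have G2: "holomorphic2_on G (UNIV \<times> {\<tau>. ereal (norm \<tau>) < tau_bound F})"
  proof -
    have "\<exists>A B. (G has_derivative (\<lambda>(h, k). A * h + B * k)) (at (z, \<tau>))"
      if \<tau>: "ereal (norm \<tau>) < tau_bound F" for z \<tau>
    proof -
      \<comment> \<open>A real \<open>y\<close> strictly in between gives the room in
        \<open>\<tau>\<close> that differentiability needs; density in the extended reals also
        covers an infinite \<open>tau_bound\<close>.\<close>
      obtain y where y: "ereal (norm \<tau>) < ereal y" "ereal y < tau_bound F"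
        using ereal_dense2[OF \<tau>] by blast
      then have "norm \<tau> < y" by simp
      moreover from this have "y \<ge> 0" using norm_ge_zero[of \<tau>] by linarith
      ultimately show ?thesis using holG[OF gs[of y]] y(2) by blast
    qed
    then show ?thesis by (auto simp: holomorphic2_on_def intro!: open_Times open_tau_domain)
  qed
  show ?thesis
  proof (intro conjI)
    show "\<forall>\<tau>. (situation_S2 F \<longrightarrow> ereal (norm \<tau>) < tau_bound F) \<longrightarrow>
        (\<forall>z. \<exists>L. (\<lambda>k. heat_term F k z \<tau>) sums L \<and>
             (\<forall>s. s ^ 2 = \<tau> \<longrightarrow> (\<lambda>n. a n * scaled_He s n z) sums L))"
    proof (intro allI impI)
      fix \<tau> z :: complex
      assume "situation_S2 F \<longrightarrow> ereal (norm \<tau>) < tau_bound F"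
      note conv' = conv[OF this]
      show "\<exists>L. (\<lambda>k. heat_term F k z \<tau>) sums L \<and>
          (\<forall>s. s ^ 2 = \<tau> \<longrightarrow> (\<lambda>n. a n * scaled_He s n z) sums L)"
        by (intro exI[of _ "G (z, \<tau>)"] conjI allI impI conv')
    qed
  next
    show "situation_S1 F \<longrightarrow> (\<forall>C1 > 0. \<forall>C2 > 0.
        abs_uniformly_summable_on (\<lambda>k (z, \<tau>). heat_term F k z \<tau>) (cball 0 C1 \<times> cball 0 C2) \<and>
        (\<forall>sq. (\<forall>\<tau>. sq \<tau> ^ 2 = \<tau>) \<longrightarrow>
           abs_uniformly_summable_on (\<lambda>n (z, \<tau>). a n * scaled_He (sq \<tau>) n z)
             (cball 0 C1 \<times> cball 0 C2)))"
    proof (intro impI allI conjI)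
      fix C1 C2 :: real and sq :: "complex \<Rightarrow> complex"
      assume "situation_S1 F" and C1: "C1 > 0"
      then have a: "gauss_summable a C2" if "C2 \<ge> 0"
        using gs[OF that] excl by blast
      show "abs_uniformly_summable_on (\<lambda>k (z, \<tau>). heat_term F k z \<tau>) (cball 0 C1 \<times> cball 0 C2)"
        using C1 by (intro abs_uniformly_summable_heat[OF sums hol a]) simp_all
      assume "\<forall>\<tau>. sq \<tau> ^ 2 = \<tau>"
      then show "abs_uniformly_summable_on (\<lambda>n (z, \<tau>). a n * scaled_He (sq \<tau>) n z)
          (cball 0 C1 \<times> cball 0 C2)"
        using C1 by (intro abs_uniformly_summable_hermite[OF a]) simp_all
    qed
  next
    show "situation_S2 F \<longrightarrow> (\<forall>C1 > 0. \<forall>C2. ereal C2 < tau_bound F \<longrightarrow>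
        abs_uniformly_summable_on (\<lambda>k (z, \<tau>). heat_term F k z \<tau>) (cball 0 C1 \<times> cball 0 C2) \<and>
        (\<forall>sq. (\<forall>\<tau>. sq \<tau> ^ 2 = \<tau>) \<longrightarrow>
           abs_uniformly_summable_on (\<lambda>n (z, \<tau>). a n * scaled_He (sq \<tau>) n z)
             (cball 0 C1 \<times> cball 0 C2)))"
    proof (intro impI allI conjI)
      fix C1 C2 :: real and sq :: "complex \<Rightarrow> complex"
      assume "ereal C2 < tau_bound F" and C1: "C1 > 0"
      then have a: "gauss_summable a C2" if "C2 \<ge> 0"
        using gs[OF that] by blast
      show "abs_uniformly_summable_on (\<lambda>k (z, \<tau>). heat_term F k z \<tau>) (cball 0 C1 \<times> cball 0 C2)"
        using C1 by (intro abs_uniformly_summable_heat[OF sums hol a]) simp_all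
      assume "\<forall>\<tau>. sq \<tau> ^ 2 = \<tau>"
      then show "abs_uniformly_summable_on (\<lambda>n (z, \<tau>). a n * scaled_He (sq \<tau>) n z)
          (cball 0 C1 \<times> cball 0 C2)"
        using C1 by (intro abs_uniformly_summable_hermite[OF a]) simp_all
    qed
  next
    show "\<exists>G. (situation_S1 F \<longrightarrow> holomorphic2_on G UNIV) \<and>
          (situation_S2 F \<longrightarrow> holomorphic2_on G (UNIV \<times> {\<tau>. ereal (norm \<tau>) < tau_bound F})) \<and>
          (\<forall>z \<tau>. (situation_S2 F \<longrightarrow> ereal (norm \<tau>) < tau_bound F) \<longrightarrow>
             (\<lambda>k. heat_term F k z \<tau>) sums G (z, \<tau>) \<and>
             (\<forall>s. s ^ 2 = \<tau> \<longrightarrow> (\<lambda>n. a n * scaled_He s n z) sums G (z, \<tau>)))"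
    proof (intro exI[of _ G] conjI allI impI)
      fix z \<tau> :: complex
      assume \<tau>: "situation_S2 F \<longrightarrow> ereal (norm \<tau>) < tau_bound F"
      show "(\<lambda>k. heat_term F k z \<tau>) sums G (z, \<tau>)" by (rule conv(1)[OF \<tau>])
      show "(\<lambda>n. a n * scaled_He s n z) sums G (z, \<tau>)" if "s ^ 2 = \<tau>" for s
        using that by (rule conv(2)[OF \<tau>])
    next
      show "holomorphic2_on G UNIV" if "situation_S1 F" by (rule G1[OF that])
      show "holomorphic2_on G (UNIV \<times> {\<tau>. ereal (norm \<tau>) < tau_bound F})" by (rule G2)
    qed
  qed
qed

end
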